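(* Let $n\ge 0$ be an integer, let $\nu\in\mathbb{R}$, and let $t\in\mathbb{C}$ with $\Re t>0$. Then $$\frac{\partial^{n}}{\partial\nu^{n}}Y_{\nu}(t)=\frac{1}{\pi}\int_{0}^{\pi}x^{n}\sin\left(t\sin x-\nu x-\frac{\pi}{2}n\right)dx-\frac{1}{\pi}\int_{0}^{\infty}e^{-t\sinh x}\left(x^{n}e^{\nu x}+e^{-\nu x}\,\Re\left[(i\pi-x)^{n}e^{i\pi\nu}\right]\right)dx$$ $$=\frac{1}{\pi}\int_{0}^{\pi}x^{n}\sin\left(t\sin x-\nu x-\frac{\pi}{2}n\right)dx-\frac{1}{\pi}\int_{0}^{\infty}e^{-t\sinh x}\left(x^{n}e^{\nu x}+e^{-\nu x}\left[p_{n}(x)\cos\pi\nu-q_{n}(x)\sin\pi\nu\right]\right)dx .$$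
   Context: $J_\nu(t)=\sum_{k=0}^{\infty}\frac{(-1)^k}{k!\,\Gamma(k+\nu+1)}\left(\frac{t}{2}\right)^{2k+\nu}$ is the Bessel function of the first kind (principal branch, $-\pi<\arg t\le\pi$; $1/\Gamma$ is zero at the poles of $\Gamma$), and $Y_\nu(t)=\frac{J_\nu(t)\cos\pi\nu-J_{-\nu}(t)}{\sin\pi\nu}$ (for integer $\nu$, the limit in $\nu$) is the Bessel function of the second kind. $\Re$ and $\Im$ denote real and imaginary parts. For real $x$, the polynomials $p_n,q_n$ are $p_{n}(x)=\Re\left[(i\pi-x)^{n}\right]=\sum_{k=0}^{\lfloor n/2\rfloor}\binom{n}{2k}(-1)^{n+k}\pi^{2k}x^{n-2k}$ and $q_{n}(x)=\Im\left[(i\pi-x)^{n}\right]=\sum_{k=0}^{\lfloor (n-1)/2\rfloor}\binom{n}{2k+1}(-1)^{n+k+1}\pi^{2k+1}x^{n-2k-1}$ (empty sums are $0$). *)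

theory Defs
  imports "HOL-Analysis.Analysis"
begin

(* rGamma is the entire function 1/Gamma, zero at the poles of Gamma; powr on complex uses the
   principal branch of the logarithm.  Since 0 powr z = 0 for every complex z, the value at
   t = 0 is not meaningful. *)
definition bessel_J :: "complex \<Rightarrow> complex \<Rightarrow> complex" where
  "bessel_J \<nu> t =
     (\<Sum>k. (-1) ^ k / fact k * rGamma (of_nat k + \<nu> + 1) * (t / 2) powr (2 * of_nat k + \<nu>))"

definition bessel_Y_quotient :: "complex \<Rightarrow> complex \<Rightarrow> complex" where
  "bessel_Y_quotient \<nu> t =
     (bessel_J \<nu> t * cos (of_real pi * \<nu>) - bessel_J (- \<nu>) t) / sin (of_real pi * \<nu>)"

definition bessel_Y :: "complex \<Rightarrow> complex \<Rightarrow> complex" where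
  "bessel_Y \<nu> t =
     (if \<nu> \<in> \<int> then Lim (at \<nu>) (\<lambda>\<mu>. bessel_Y_quotient \<mu> t) else bessel_Y_quotient \<nu> t)"

(* Only meaningful together with differentiability of the derivatives of lower order. *)
definition nth_derivative :: "nat \<Rightarrow> (real \<Rightarrow> 'a::real_normed_vector) \<Rightarrow> real \<Rightarrow> 'a" where
  "nth_derivative n f = ((\<lambda>g x. vector_derivative g (at x)) ^^ n) f"

definition p_poly :: "nat \<Rightarrow> real \<Rightarrow> real" where
  "p_poly n x = Re ((\<i> * of_real pi - of_real x) ^ n)"

definition q_poly :: "nat \<Rightarrow> real \<Rightarrow> real" where
  "q_poly n x = Im ((\<i> * of_real pi - of_real x) ^ n)"

lemma binomial_expansion_ipi_minus:
  "(\<i> * of_real pi - of_real x) ^ n =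
     (\<Sum>j\<le>n. \<i> ^ j * of_real (real (n choose j) * pi ^ j * (- x) ^ (n - j)))"
proof -
  have "(\<i> * of_real pi - of_real x) ^ n = (\<i> * of_real pi + of_real (- x) :: complex) ^ n"
    by simp
  also have "\<dots> = (\<Sum>j\<le>n. of_nat (n choose j) * (\<i> * of_real pi) ^ j * of_real (- x) ^ (n - j))"
    by (rule binomial_ring)
  also have "\<dots> = (\<Sum>j\<le>n. \<i> ^ j * of_real (real (n choose j) * pi ^ j * (- x) ^ (n - j)))"
    by (intro sum.cong refl) (simp add: power_mult_distrib)
  finally show ?thesis .
qed

lemma p_poly_eq_sum:
  "p_poly n x =
     (\<Sum>k = 0..n div 2. real (n choose (2 * k)) * (-1) ^ (n + k) * pi ^ (2 * k) * x ^ (n - 2 * k))"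
proof -
  let ?c = "\<lambda>j. real (n choose j) * pi ^ j * (- x) ^ (n - j)"
  have "p_poly n x = (\<Sum>j\<le>n. Re (\<i> ^ j * of_real (?c j)))"
    unfolding p_poly_def binomial_expansion_ipi_minus by (rule Re_sum)
  also have "\<dots> = (\<Sum>j \<in> (\<lambda>k. 2 * k) ` {0..n div 2}. Re (\<i> ^ j * of_real (?c j)))"
  proof (intro sum.mono_neutral_right ballI)
    fix j assume j: "j \<in> {..n} - (\<lambda>k. 2 * k) ` {0..n div 2}"
    have "odd j"
    proof
      assume "even j"
      then obtain k where "j = 2 * k" by blast
      with j show False by auto
    qed
    then obtain k where "j = 2 * k + 1" by (blast elim: oddE)
    then have "\<i> ^ j = \<i> * of_real ((-1) ^ k)"
      by (simp add: power_mult)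
    then show "Re (\<i> ^ j * of_real (?c j)) = 0"
      by (simp only: mult.assoc Re_i_times Im_complex_of_real minus_zero flip: of_real_mult)
  qed auto
  also have "\<dots> = (\<Sum>k = 0..n div 2. Re (\<i> ^ (2 * k) * of_real (?c (2 * k))))"
    by (subst sum.reindex) (auto simp: inj_on_def)
  also have "\<dots> = (\<Sum>k = 0..n div 2.
      real (n choose (2 * k)) * (-1) ^ (n + k) * pi ^ (2 * k) * x ^ (n - 2 * k))"
  proof (intro sum.cong refl)
    fix k assume "k \<in> {0..n div 2}"
    then have "2 * k \<le> n" by auto
    then have "(-1 :: real) ^ (n - 2 * k) = (-1) ^ n"
      by (auto simp: minus_one_power_iff)
    then have "(- x) ^ (n - 2 * k) = (-1) ^ n * x ^ (n - 2 * k)"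
      by (subst power_minus) simp
    moreover have "\<i> ^ (2 * k) = of_real ((-1) ^ k)"
      by (simp add: power_mult)
    ultimately show "Re (\<i> ^ (2 * k) * of_real (?c (2 * k))) =
        real (n choose (2 * k)) * (-1) ^ (n + k) * pi ^ (2 * k) * x ^ (n - 2 * k)"
      by (simp only: Re_complex_of_real flip: of_real_mult) (simp add: power_add mult_ac)
  qed
  finally show ?thesis .
qed

(* For n = 0 truncated subtraction leaves the single summand k = 0, whose binomial coefficient is 0. *)
lemma q_poly_eq_sum:
  "q_poly n x =
     (\<Sum>k = 0..(n - 1) div 2. real (n choose (2 * k + 1)) * (-1) ^ (n + k + 1) *
        pi ^ (2 * k + 1) * x ^ (n - 2 * k - 1))"
proof (cases "n = 0")
  case True
  then show ?thesis by (simp add: q_poly_def)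
next
  case False
  let ?c = "\<lambda>j. real (n choose j) * pi ^ j * (- x) ^ (n - j)"
  have "q_poly n x = (\<Sum>j\<le>n. Im (\<i> ^ j * of_real (?c j)))"
    unfolding q_poly_def binomial_expansion_ipi_minus by (rule Im_sum)
  also have "\<dots> = (\<Sum>j \<in> (\<lambda>k. 2 * k + 1) ` {0..(n - 1) div 2}. Im (\<i> ^ j * of_real (?c j)))"
  proof (intro sum.mono_neutral_right ballI)
    show "(\<lambda>k. 2 * k + 1) ` {0..(n - 1) div 2} \<subseteq> {..n}"
      using False by auto
    fix j assume j: "j \<in> {..n} - (\<lambda>k. 2 * k + 1) ` {0..(n - 1) div 2}"
    have "even j"
    proof (rule ccontr)
      assume "odd j"
      then obtain k where "j = 2 * k + 1" by (blast elim: oddE)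
      with j show False by auto
    qed
    then obtain k where "j = 2 * k" by blast
    then have "\<i> ^ j = of_real ((-1) ^ k)"
      by (simp add: power_mult)
    then show "Im (\<i> ^ j * of_real (?c j)) = 0"
      by (simp only: Im_complex_of_real flip: of_real_mult)
  qed auto
  also have "\<dots> = (\<Sum>k = 0..(n - 1) div 2. Im (\<i> ^ (2 * k + 1) * of_real (?c (2 * k + 1))))"
    by (subst sum.reindex) (auto simp: inj_on_def)
  also have "\<dots> = (\<Sum>k = 0..(n - 1) div 2. real (n choose (2 * k + 1)) * (-1) ^ (n + k + 1) *
      pi ^ (2 * k + 1) * x ^ (n - 2 * k - 1))"
  proof (intro sum.cong refl)
    fix k assume "k \<in> {0..(n - 1) div 2}"
    then have "2 * k + 1 \<le> n" using False by auto
    then have "(-1 :: real) ^ (n - (2 * k + 1)) = (-1) ^ (n + 1)"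
      by (auto simp: minus_one_power_iff)
    then have "(- x) ^ (n - (2 * k + 1)) = (-1) ^ (n + 1) * x ^ (n - (2 * k + 1))"
      by (subst power_minus) simp
    moreover have "\<i> ^ (2 * k + 1) = \<i> * of_real ((-1) ^ k)"
      by (simp add: power_mult)
    ultimately show "Im (\<i> ^ (2 * k + 1) * of_real (?c (2 * k + 1))) =
        real (n choose (2 * k + 1)) * (-1) ^ (n + k + 1) * pi ^ (2 * k + 1) * x ^ (n - 2 * k - 1)"
      by (simp only: mult.assoc Im_i_times Re_complex_of_real flip: of_real_mult)
         (simp add: power_add mult_ac)
  qed
  finally show ?thesis .
qed

end

(* Summing the Bessel series under Hankel's loop integral for 1/Gamma, with the loop collapsed onto
   the unit circle and the two sides of the cut outside it, gives Schlaefli's integral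
     J_nu(t) = 1/(2 pi) int_{-pi}^{pi} e^{i(t sin x - nu x)} dx
               - sin(pi nu)/pi int_0^oo e^{-t sinh x - nu x} dx      (Re t > 0)
   for every complex nu.  Hankel's formula, with integrand e^{aw} w^{-p-1}, needs no contour
   integration: for Re p < 0 the circle and the segment (0,1) have, up to the factor -sin(pi p)/pi,
   the same power series in a, so together with the tail they make up Euler's integral for
   Gamma(-p); this case follows by reflection, and the others by the identity theorem in p.
   In the quotient defining Y_nu, reflecting x to pi - x cancels the zeros of sin(pi nu), so the
   resulting formula is entire in nu: it also gives the limit at integers, and it may be
   differentiated under the integral. *)
theory Submission
  imports Defs "HOL-Complex_Analysis.Conformal_Mappings"
begin

section \<open>Exponential integrals depending on a complex parameter\<close>

text \<open>Continuity on a closed set yields Lebesgue measurability, so an integrable majorant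
  suffices.\<close>

lemma continuous_dominated_absolutely_integrable:
  fixes f :: "real \<Rightarrow> complex"
  assumes "closed S" "continuous_on S f" "g integrable_on S"
    and "\<And>x. x \<in> S \<Longrightarrow> norm (f x) \<le> g x"
  shows "f absolutely_integrable_on S"
proof (rule measurable_bounded_by_integrable_imp_absolutely_integrable)
  show S: "S \<in> sets lebesgue"
    using assms(1) by (simp add: borel_closed)
  show "f \<in> borel_measurable (lebesgue_on S)"
    by (rule continuous_imp_measurable_on_sets_lebesgue[OF assms(2) S])
qed (use assms in auto)

text \<open>A single term of the exponential series at \<open>\<epsilon> * y\<close> is at most its
  sum.\<close>

lemma power_le_fact_exp:
  fixes \<epsilon> y :: real
  assumes "\<epsilon> > 0" "y \<ge> 0"
  shows "y ^ n \<le> fact n / \<epsilon> ^ n * exp (\<epsilon> * y)"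
proof -
  have "(\<epsilon> * y) ^ n / fact n \<le> exp (\<epsilon> * y)"
    using sum_le_suminf[OF summable_exp[of "\<epsilon> * y"], of "{n}"] assms
    by (simp add: exp_def scaleR_conv_of_real field_simps)
  then show ?thesis
    using assms by (simp add: field_simps power_mult_distrib)
qed

text \<open>Taylor remainder after the linear term. The square is what makes the error of a
  difference quotient tend to zero.\<close>

lemma norm_exp_minus_linear_le:
  fixes w :: complex
  shows "norm (exp w - 1 - w) \<le> norm w ^ 2 * exp (norm w)"
  using Taylor_exp_field[of w 1] by (simp add: algebra_simps power2_eq_square)

text \<open>Formally the \<open>n\<close>-th derivative in \<open>z\<close> of the integral of
  \<open>w x * exp (z * c x)\<close>. A complex exponent \<open>c\<close> lets one family cover the
  circle, the cut and the Gamma integral with a complex scale.\<close>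

definition exp_moment :: "real set \<Rightarrow> (real \<Rightarrow> complex) \<Rightarrow> (real \<Rightarrow> complex) \<Rightarrow> nat \<Rightarrow> complex \<Rightarrow> complex"
  where "exp_moment S w c n z = integral S (\<lambda>x. w x * c x ^ n * exp (z * c x))"

text \<open>The margin \<open>\<epsilon>\<close> absorbs both the powers of \<open>c\<close> and small changes of \<open>z\<close>.\<close>
definition exp_integrable :: "real set \<Rightarrow> (real \<Rightarrow> complex) \<Rightarrow> (real \<Rightarrow> complex) \<Rightarrow> complex \<Rightarrow> bool"
  where "exp_integrable S w c z \<longleftrightarrow>
    closed S \<and> continuous_on S w \<and> continuous_on S c \<and>
    (\<exists>\<epsilon>>0. (\<lambda>x. norm (w x * exp (z * c x)) * exp (\<epsilon> * norm (c x))) integrable_on S)"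

section \<open>Differentiation of exponential integrals under the integral sign\<close>

lemma exp_integrable_compact:
  assumes "continuous_on {a..b} w" "continuous_on {a..b} c"
  shows "exp_integrable {a..b} w c z"
  unfolding exp_integrable_def
  using assms by (auto intro!: exI[of _ 1] integrable_continuous_interval continuous_intros)

text \<open>Half of the margin pays for the power of \<open>norm (c x)\<close>, by
  \<open>power_le_fact_exp\<close>. The other half remains, and it is the same for all
  \<open>n\<close>.\<close>

lemma exp_integrable_moment_bound:
  assumes "exp_integrable S w c z"
  obtains \<epsilon> where "\<epsilon> > 0"
    "\<And>n. (\<lambda>x. norm (w x * exp (z * c x)) * norm (c x) ^ n * exp (\<epsilon> * norm (c x))) integrable_on S"
proof -
  from assms obtain \<epsilon> where \<epsilon>: "\<epsilon> > 0"
      "(\<lambda>x. norm (w x * exp (z * c x)) * exp (\<epsilon> * norm (c x))) integrable_on S"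
    and c: "closed S" "continuous_on S w" "continuous_on S c"
    by (auto simp: exp_integrable_def)
  have "(\<lambda>x. norm (w x * exp (z * c x)) * norm (c x) ^ n * exp (\<epsilon> / 2 * norm (c x))) integrable_on S"
    (is "?f integrable_on S") for n
  proof -
    \<comment> \<open>The real integrand is embedded into the complex numbers only to apply the
      complex domination criterion; \<open>Re\<close> undoes this below.\<close>
    have "(\<lambda>x. of_real (?f x) :: complex) absolutely_integrable_on S"
    proof (rule continuous_dominated_absolutely_integrable[OF c(1)])
      show "continuous_on S (\<lambda>x. of_real (?f x) :: complex)"
        by (intro continuous_intros c)
      show "(\<lambda>x. norm (w x * exp (z * c x)) * exp (\<epsilon> * norm (c x)) * (fact n / (\<epsilon> / 2) ^ n))
          integrable_on S"
        by (rule integrable_on_mult_left[OF \<epsilon>(2)])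
      fix x
      have "norm (c x) ^ n * exp (\<epsilon> / 2 * norm (c x))
          \<le> fact n / (\<epsilon> / 2) ^ n * exp (\<epsilon> / 2 * norm (c x)) * exp (\<epsilon> / 2 * norm (c x))"
        using \<epsilon> by (intro mult_right_mono power_le_fact_exp) auto
      also have "\<dots> = exp (\<epsilon> * norm (c x)) * (fact n / (\<epsilon> / 2) ^ n)"
        by (simp add: mult.assoc flip: exp_add)
      finally have "norm (w x * exp (z * c x)) * (norm (c x) ^ n * exp (\<epsilon> / 2 * norm (c x)))
          \<le> norm (w x * exp (z * c x)) * (exp (\<epsilon> * norm (c x)) * (fact n / (\<epsilon> / 2) ^ n))"
        by (intro mult_left_mono) auto
      then show "norm (of_real (?f x) :: complex)
          \<le> norm (w x * exp (z * c x)) * exp (\<epsilon> * norm (c x)) * (fact n / (\<epsilon> / 2) ^ n)"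
        by (simp add: mult.assoc norm_mult norm_power del: norm_exp_eq_Re)
    qed
    from absolutely_integrable_linear[OF this bounded_linear_Re] show ?thesis
      by (auto simp: o_def absolutely_integrable_on_def)
  qed
  with that[of "\<epsilon> / 2"] \<epsilon> show ?thesis by auto
qed

lemma exp_moment_absolutely_integrable:
  assumes "exp_integrable S w c z"
  shows "(\<lambda>x. w x * c x ^ n * exp (z * c x)) absolutely_integrable_on S"
proof -
  from assms obtain \<epsilon> where \<epsilon>: "\<epsilon> > 0"
    "\<And>n. (\<lambda>x. norm (w x * exp (z * c x)) * norm (c x) ^ n * exp (\<epsilon> * norm (c x))) integrable_on S"
    by (rule exp_integrable_moment_bound) blast
  show ?thesis
  proof (rule continuous_dominated_absolutely_integrable[OF _ _ \<epsilon>(2)[of n]])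
    show "continuous_on S (\<lambda>x. w x * c x ^ n * exp (z * c x))"
      using assms by (intro continuous_intros) (auto simp: exp_integrable_def)
    fix x
    have "norm (w x * exp (z * c x)) * norm (c x) ^ n * 1
      \<le> norm (w x * exp (z * c x)) * norm (c x) ^ n * exp (\<epsilon> * norm (c x))"
      using \<epsilon> by (intro mult_left_mono) auto
    then show "norm (w x * c x ^ n * exp (z * c x))
      \<le> norm (w x * exp (z * c x)) * norm (c x) ^ n * exp (\<epsilon> * norm (c x))"
      by (simp add: norm_mult norm_power mult_ac del: norm_exp_eq_Re)
  qed (use assms in \<open>auto simp: exp_integrable_def\<close>)
qed

lemma has_integral_exp_moment:
  assumes "exp_integrable S w c z"
  shows "((\<lambda>x. w x * c x ^ n * exp (z * c x)) has_integral exp_moment S w c n z) S"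
  using exp_moment_absolutely_integrable[OF assms, of n]
  by (simp add: exp_moment_def absolutely_integrable_on_def integrable_integral)

text \<open>Half of the margin dominates \<open>exp (h * c x)\<close> for small \<open>h\<close>;
  the other half survives as the margin at \<open>z + h\<close>.\<close>

lemma exp_integrable_perturb:
  assumes "exp_integrable S w c z"
  obtains \<delta> where "\<delta> > 0" "\<And>h. norm h < \<delta> \<Longrightarrow> exp_integrable S w c (z + h)"
proof -
  from assms obtain \<epsilon> where \<epsilon>: "\<epsilon> > 0"
      "(\<lambda>x. norm (w x * exp (z * c x)) * exp (\<epsilon> * norm (c x))) integrable_on S"
    and c: "closed S" "continuous_on S w" "continuous_on S c"
    by (auto simp: exp_integrable_def)
  have "exp_integrable S w c (z + h)" if h: "norm h < \<epsilon> / 2" for h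
  proof -
    let ?f = "\<lambda>x. norm (w x * exp ((z + h) * c x)) * exp (\<epsilon> / 2 * norm (c x))"
    have "(\<lambda>x. of_real (?f x) :: complex) absolutely_integrable_on S"
    proof (rule continuous_dominated_absolutely_integrable[OF c(1) _ \<epsilon>(2)])
      show "continuous_on S (\<lambda>x. of_real (?f x) :: complex)"
        by (intro continuous_intros c)
      fix x
      have "norm (exp (h * c x)) \<le> exp (norm (h * c x))"
        by (rule norm_exp)
      also have "\<dots> \<le> exp (\<epsilon> / 2 * norm (c x))"
        using mult_right_mono[of "norm h" "\<epsilon> / 2" "norm (c x)"] h by (simp add: norm_mult)
      finally have "norm (exp (h * c x)) * exp (\<epsilon> / 2 * norm (c x))
          \<le> exp (\<epsilon> / 2 * norm (c x)) * exp (\<epsilon> / 2 * norm (c x))"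
        by (intro mult_right_mono) auto
      also have "\<dots> = exp (\<epsilon> * norm (c x))"
        by (simp flip: exp_add)
      finally have "norm (w x * exp (z * c x)) * (norm (exp (h * c x)) * exp (\<epsilon> / 2 * norm (c x)))
          \<le> norm (w x * exp (z * c x)) * exp (\<epsilon> * norm (c x))"
        by (intro mult_left_mono) auto
      then show "norm (of_real (?f x) :: complex)
          \<le> norm (w x * exp (z * c x)) * exp (\<epsilon> * norm (c x))"
        by (simp add: mult.assoc norm_mult ring_distribs exp_add del: norm_exp_eq_Re)
    qed
    from absolutely_integrable_linear[OF this bounded_linear_Re] have "?f integrable_on S"
      by (auto simp: o_def absolutely_integrable_on_def)
    with c \<epsilon> show ?thesis
      unfolding exp_integrable_def by (auto intro!: exI[of _ "\<epsilon> / 2"])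
  qed
  with that[of "\<epsilon> / 2"] \<epsilon> show ?thesis by auto
qed

text \<open>Absorbing the power into the weight reduces the derivative of a moment of any order to
  that of order zero.\<close>

lemma exp_integrable_weight_power:
  assumes "exp_integrable S w c z"
  shows "exp_integrable S (\<lambda>x. w x * c x ^ n) c z"
proof -
  from assms obtain \<epsilon> where \<epsilon>: "\<epsilon> > 0"
    "\<And>n. (\<lambda>x. norm (w x * exp (z * c x)) * norm (c x) ^ n * exp (\<epsilon> * norm (c x))) integrable_on S"
    by (rule exp_integrable_moment_bound) blast
  from \<epsilon>(2)[of n]
  have "(\<lambda>x. norm (w x * c x ^ n * exp (z * c x)) * exp (\<epsilon> * norm (c x))) integrable_on S"
    by (simp add: norm_mult norm_power mult_ac del: norm_exp_eq_Re)
  with \<epsilon>(1) assms show ?thesis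
    unfolding exp_integrable_def by (auto intro!: continuous_intros)
qed

text \<open>The difference quotient misses the first moment by at most \<open>norm h * B\<close>,
  where \<open>B\<close> is a second moment weighted by the margin: the remainder of
  \<open>exp (h * c x)\<close> is quadratic in \<open>h * c x\<close>, and the margin absorbs its
  exponential factor once \<open>norm h < \<epsilon>\<close>.\<close>

lemma exp_moment_0_has_field_derivative:
  assumes "exp_integrable S w c z"
  shows "(exp_moment S w c 0 has_field_derivative exp_moment S w c 1 z) (at z)"
proof -
  from assms obtain \<epsilon> where \<epsilon>: "\<epsilon> > 0"
    "\<And>n. (\<lambda>x. norm (w x * exp (z * c x)) * norm (c x) ^ n * exp (\<epsilon> * norm (c x))) integrable_on S"
    by (rule exp_integrable_moment_bound) blast
  from assms obtain \<delta> where \<delta>: "\<delta> > 0" "\<And>h. norm h < \<delta> \<Longrightarrow> exp_integrable S w c (z + h)"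
    by (rule exp_integrable_perturb) blast
  define B where
    "B = integral S (\<lambda>x. norm (w x * exp (z * c x)) * norm (c x) ^ 2 * exp (\<epsilon> * norm (c x)))"
  note int = absolutely_integrable_on_def[THEN iffD1, THEN conjunct1, OF exp_moment_absolutely_integrable]
  have bound: "norm ((exp_moment S w c 0 (z + h) - exp_moment S w c 0 z) / h - exp_moment S w c 1 z)
      \<le> norm h * B" if h: "norm h < \<delta>" "norm h < \<epsilon>" "h \<noteq> 0" for h
  proof -
    let ?E = "\<lambda>x. w x * c x ^ 0 * exp ((z + h) * c x) - w x * c x ^ 0 * exp (z * c x)
      - h * (w x * c x ^ 1 * exp (z * c x))"
    have "norm (integral S ?E) \<le> integral S (\<lambda>x. norm h ^ 2 *
        (norm (w x * exp (z * c x)) * norm (c x) ^ 2 * exp (\<epsilon> * norm (c x))))"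
    proof (rule integral_norm_bound_integral)
      show "?E integrable_on S"
        by (intro integrable_diff int \<delta> h assms integrable_on_mult_right)
      show "(\<lambda>x. norm h ^ 2 *
        (norm (w x * exp (z * c x)) * norm (c x) ^ 2 * exp (\<epsilon> * norm (c x)))) integrable_on S"
        by (intro integrable_on_mult_right \<epsilon>)
      fix x
      have "?E x = w x * exp (z * c x) * (exp (h * c x) - 1 - h * c x)"
        by (simp add: algebra_simps exp_add)
      then have "norm (?E x) = norm (w x * exp (z * c x)) * norm (exp (h * c x) - 1 - h * c x)"
        by (simp add: norm_mult)
      also have "\<dots> \<le> norm (w x * exp (z * c x)) * (norm (h * c x) ^ 2 * exp (norm (h * c x)))"
        by (intro mult_left_mono norm_exp_minus_linear_le) auto
      also have "\<dots> \<le> norm (w x * exp (z * c x)) * (norm (h * c x) ^ 2 * exp (\<epsilon> * norm (c x)))"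
        using h by (intro mult_left_mono) (auto simp: norm_mult intro!: mult_right_mono)
      finally show "norm (?E x) \<le> norm h ^ 2 *
        (norm (w x * exp (z * c x)) * norm (c x) ^ 2 * exp (\<epsilon> * norm (c x)))"
        by (simp add: norm_mult power_mult_distrib mult_ac del: norm_exp_eq_Re)
    qed
    also have "integral S ?E = exp_moment S w c 0 (z + h) - exp_moment S w c 0 z - h * exp_moment S w c 1 z"
      unfolding exp_moment_def
      by (subst integral_diff, (intro integrable_diff int \<delta> h assms integrable_on_mult_right)+)+
         (subst integral_mult_right, rule refl)
    also have "\<dots> = h * ((exp_moment S w c 0 (z + h) - exp_moment S w c 0 z) / h - exp_moment S w c 1 z)"
      using h by (simp add: field_simps)
    also have "integral S (\<lambda>x. norm h ^ 2 *
        (norm (w x * exp (z * c x)) * norm (c x) ^ 2 * exp (\<epsilon> * norm (c x)))) = norm h ^ 2 * B"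
      by (simp add: B_def)
    finally show ?thesis
      using h by (simp add: norm_mult power2_eq_square)
  qed
  have "((\<lambda>h. (exp_moment S w c 0 (z + h) - exp_moment S w c 0 z) / h - exp_moment S w c 1 z) \<longlongrightarrow> 0) (at 0)"
  proof (rule Lim_null_comparison)
    show "\<forall>\<^sub>F h in at 0. norm ((exp_moment S w c 0 (z + h) - exp_moment S w c 0 z) / h
        - exp_moment S w c 1 z) \<le> norm h * B"
      unfolding eventually_at using \<epsilon>(1) \<delta>(1)
      by (intro exI[of _ "min \<delta> \<epsilon>"]) (auto intro!: bound[unfolded One_nat_def])
    show "((\<lambda>h. norm h * B) \<longlongrightarrow> 0) (at 0)"
      by (auto intro!: tendsto_eq_intros)
  qed
  then show ?thesis
    unfolding DERIV_def using Lim_null by blast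
qed

lemma exp_moment_has_field_derivative:
  assumes "exp_integrable S w c z"
  shows "(exp_moment S w c n has_field_derivative exp_moment S w c (Suc n) z) (at z)"
proof -
  have "exp_moment S (\<lambda>x. w x * c x ^ n) c 0 = exp_moment S w c n"
       "exp_moment S (\<lambda>x. w x * c x ^ n) c 1 = exp_moment S w c (Suc n)"
    by (auto simp: exp_moment_def fun_eq_iff mult_ac)
  with exp_moment_0_has_field_derivative[OF exp_integrable_weight_power[OF assms, of n]]
  show ?thesis by simp
qed

lemma exp_moment_holomorphic:
  assumes "\<And>z. z \<in> A \<Longrightarrow> exp_integrable S w c z"
  shows "exp_moment S w c n holomorphic_on A"
  unfolding holomorphic_on_def field_differentiable_def
  using assms by (blast intro: has_field_derivative_at_within exp_moment_has_field_derivative)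

text \<open>Since \<open>norm (g x) \<le> 1\<close>, all partial sums of the series of
  \<open>exp (a * g x)\<close> are bounded by \<open>exp (norm a)\<close>, and dominated convergence
  allows integration term by term. This serves both Hankel's formula and the summation of the Bessel
  series.\<close>

lemma integral_exp_sums:
  fixes f g :: "real \<Rightarrow> complex"
  assumes S: "closed S" and f: "f absolutely_integrable_on S" "continuous_on S f"
    and g: "continuous_on S g" "\<And>x. x \<in> S \<Longrightarrow> norm (g x) \<le> 1"
  shows "(\<lambda>k. a ^ k / fact k * integral S (\<lambda>x. f x * g x ^ k)) sums
    integral S (\<lambda>x. f x * exp (a * g x))"
proof -
  have fint: "(\<lambda>x. norm (f x)) integrable_on S"
    using f by (auto simp: absolutely_integrable_on_def)
  have intk: "(\<lambda>x. f x * g x ^ k) integrable_on S" for k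
  proof -
    have "(\<lambda>x. f x * g x ^ k) absolutely_integrable_on S"
      by (rule continuous_dominated_absolutely_integrable[OF S _ fint])
         (auto intro!: continuous_intros f g mult_left_le power_le_one simp: norm_mult norm_power)
    then show ?thesis by (auto simp: absolutely_integrable_on_def)
  qed
  let ?P = "\<lambda>N x. f x * (\<Sum>k<N. (a * g x) ^ k / fact k)"
  have P: "?P N = (\<lambda>x. \<Sum>k<N. a ^ k / fact k * (f x * g x ^ k))" for N
    by (auto simp: sum_distrib_left power_mult_distrib mult_ac fun_eq_iff)
  have "(\<lambda>N. integral S (?P N)) \<longlonglongrightarrow> integral S (\<lambda>x. f x * exp (a * g x))"
  proof (rule dominated_convergence)
    show "?P N integrable_on S" for N
      unfolding P by (intro integrable_sum integrable_on_mult_right intk) auto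
    show "(\<lambda>x. norm (f x) * exp (norm a)) integrable_on S"
      by (rule integrable_on_mult_left[OF fint])
    fix N x assume x: "x \<in> S"
    have "norm (\<Sum>k<N. (a * g x) ^ k / fact k) \<le> (\<Sum>k<N. norm a ^ k / fact k)"
    proof (rule sum_norm_le)
      fix k
      have "norm a ^ k * norm (g x) ^ k \<le> norm a ^ k * 1"
        using g(2)[OF x] by (intro mult_left_mono power_le_one) auto
      then show "norm ((a * g x) ^ k / fact k) \<le> norm a ^ k / fact k"
        by (simp add: norm_divide norm_power norm_mult power_mult_distrib divide_right_mono)
    qed
    also have "\<dots> \<le> exp (norm a)"
      using sum_le_suminf[OF summable_exp[of "norm a"], of "{..<N}"]
      by (simp add: exp_def scaleR_conv_of_real field_simps)
    finally show "norm (?P N x) \<le> norm (f x) * exp (norm a)"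
      by (simp add: norm_mult mult_left_mono)
  next
    fix x
    have "(\<lambda>k. (a * g x) ^ k / fact k) sums exp (a * g x)"
      using exp_converges[of "a * g x"] by (simp add: scaleR_conv_of_real field_simps)
    then show "(\<lambda>N. ?P N x) \<longlonglongrightarrow> f x * exp (a * g x)"
      unfolding sums_def by (intro tendsto_intros)
  qed
  moreover have "integral S (?P N) = (\<Sum>k<N. a ^ k / fact k * integral S (\<lambda>x. f x * g x ^ k))" for N
    unfolding P by (subst integral_sum) (auto intro!: integrable_on_mult_right intk)
  ultimately show ?thesis
    by (simp add: sums_def)
qed

section \<open>The Gamma integral with a complex scale\<close>

text \<open>The real-valued change of variables is applied to real and imaginary parts, and the
  results are reassembled.\<close>

lemma absolutely_integrable_change_of_variables_complex:
  fixes f :: "real \<Rightarrow> complex" and g :: "real \<Rightarrow> real"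
  assumes S: "S \<in> sets lebesgue"
    and g: "\<And>x. x \<in> S \<Longrightarrow> (g has_field_derivative g' x) (at x within S)" "inj_on g S"
    and f: "f absolutely_integrable_on (g ` S)"
  shows "(\<lambda>x. of_real \<bar>g' x\<bar> * f (g x)) absolutely_integrable_on S"
    and "integral S (\<lambda>x. of_real \<bar>g' x\<bar> * f (g x)) = integral (g ` S) f"
proof -
  note cov = has_absolute_integral_change_of_variables_1'[OF S g, THEN iffD2]
  let ?R = "\<lambda>x. \<bar>g' x\<bar> * Re (f (g x))" and ?I = "\<lambda>x. \<bar>g' x\<bar> * Im (f (g x))"
  have fi: "f integrable_on g ` S"
    using f by (simp add: absolutely_integrable_on_def)
  have R: "?R absolutely_integrable_on S \<and> integral S ?R = Re (integral (g ` S) f)"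
    using absolutely_integrable_linear[OF f bounded_linear_Re] integral_linear[OF fi bounded_linear_Re]
    by (intro cov) (simp_all only: o_def)
  have I: "?I absolutely_integrable_on S \<and> integral S ?I = Im (integral (g ` S) f)"
    using absolutely_integrable_linear[OF f bounded_linear_Im] integral_linear[OF fi bounded_linear_Im]
    by (intro cov) (simp_all only: o_def)
  have eq: "(\<lambda>x. of_real \<bar>g' x\<bar> * f (g x)) = (\<lambda>x. of_real (?R x) + \<i> * of_real (?I x))"
    by (auto simp: fun_eq_iff complex_eq_iff)
  have R': "(\<lambda>x. complex_of_real (?R x)) absolutely_integrable_on S"
    using absolutely_integrable_linear[OF R[THEN conjunct1], of complex_of_real]
    by (simp add: o_def bounded_linear_of_real)
  have I': "(\<lambda>x. \<i> * complex_of_real (?I x)) absolutely_integrable_on S"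
    using absolutely_integrable_linear[OF I[THEN conjunct1], of "\<lambda>y. \<i> * of_real y"]
    by (simp add: o_def bounded_linear_const_mult bounded_linear_of_real)
  show "(\<lambda>x. of_real \<bar>g' x\<bar> * f (g x)) absolutely_integrable_on S"
    unfolding eq by (rule set_integral_add(1)[OF R' I'])
  have "((\<lambda>x. complex_of_real (?R x)) has_integral of_real (Re (integral (g ` S) f))) S"
    using R by (intro has_integral_of_real) (auto simp: absolutely_integrable_on_def has_integral_integral)
  moreover have "((\<lambda>x. \<i> * complex_of_real (?I x)) has_integral \<i> * of_real (Im (integral (g ` S) f))) S"
    using I by (intro has_integral_mult_right has_integral_of_real)
      (auto simp: absolutely_integrable_on_def has_integral_integral)
  ultimately have "((\<lambda>x. of_real \<bar>g' x\<bar> * f (g x)) has_integral integral (g ` S) f) S"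
    unfolding eq by (subst (3) complex_eq) (rule has_integral_add)
  then show "integral S (\<lambda>x. of_real \<bar>g' x\<bar> * f (g x)) = integral (g ` S) f"
    by (rule integral_unique)
qed

text \<open>Euler's integral for \<open>Gamma s\<close> after the substitution u = a exp x.\<close>

lemma Gamma_integral_exp_of_real:
  fixes a :: real and s :: complex
  assumes a: "a > 0" and s: "Re s > 0"
  shows "(\<lambda>x. exp (s * of_real x) * exp (- (of_real a * of_real (exp x)))) absolutely_integrable_on UNIV"
      (is "?F absolutely_integrable_on UNIV")
    and "integral UNIV (\<lambda>x. exp (s * of_real x) * exp (- (of_real a * of_real (exp x))))
      = Gamma s * of_real a powr (- s)"
proof -
  let ?f = "\<lambda>u. complex_of_real u powr (s - 1) / of_real (exp u)"
  let ?g = "\<lambda>x. a * exp x"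
  have im: "range ?g = {0<..}"
  proof (intro equalityI subsetI)
    fix y :: real assume "y \<in> {0<..}"
    then have "y = ?g (ln (y / a))" using a by simp
    then show "y \<in> range ?g" by blast
  qed (use a in auto)
  have f: "?f absolutely_integrable_on range ?g"
    using absolutely_integrable_Gamma_integral'[OF s] im by simp
  have eq: "of_real \<bar>?g x\<bar> * ?f (?g x) = of_real a powr s * ?F x" for x
  proof -
    \<comment> \<open>\<open>L\<close> is the real logarithm of \<open>a * exp x\<close>, so the
      principal power becomes an ordinary exponential.\<close>
    define L where "L = complex_of_real (ln a + x)"
    have L: "of_real (?g x) = exp L"
      unfolding L_def exp_of_real using a by (simp add: exp_add)
    have "of_real (?g x) powr (s - 1) = exp ((s - 1) * L)"
      using a by (simp add: powr_def Ln_of_real ln_mult L_def flip: of_real_mult)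
    then have "of_real \<bar>?g x\<bar> * ?f (?g x)
        = exp L * exp ((s - 1) * L) * exp (- (of_real a * of_real (exp x)))"
      using a L by (simp add: exp_minus field_simps abs_of_pos exp_of_real[symmetric])
    also have "exp L * exp ((s - 1) * L) = exp (s * of_real (ln a) + s * of_real x)"
      unfolding exp_add[symmetric] L_def by (simp add: algebra_simps)
    also have "\<dots> = of_real a powr s * exp (s * of_real x)"
      using a by (simp add: powr_def Ln_of_real exp_add)
    finally show ?thesis by simp
  qed
  have der: "(?g has_field_derivative ?g x) (at x within UNIV)" for x
    by (auto intro!: derivative_eq_intros)
  have inj: "inj ?g" using a by (auto simp: inj_on_def)
  note cov = absolutely_integrable_change_of_variables_complex[OF _ der inj f]
  have A: "(\<lambda>x. of_real a powr s * ?F x) absolutely_integrable_on UNIV"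
    using cov(1) unfolding eq by simp
  have B: "integral UNIV (\<lambda>x. of_real a powr s * ?F x) = Gamma s"
    using cov(2) integral_unique[OF Gamma_integral_complex'[OF s]] unfolding eq im by simp
  have nz: "of_real a powr s \<noteq> (0::complex)" using a by simp
  show F: "?F absolutely_integrable_on UNIV"
    using set_integrable_mult_right[OF A, of "inverse (of_real a powr s)"] nz
    by (simp add: mult.assoc[symmetric])
  show "integral UNIV ?F = Gamma s * of_real a powr (- s)"
    using B nz by (simp add: powr_minus field_simps)
qed

text \<open>Norm of the preceding integrand for real parameters; it is the majorant behind
  \<open>Gamma_integral_exp\<close> and \<open>exp_integrable_tail\<close>.\<close>

lemma integrable_exp_minus_exp:
  fixes \<alpha> \<sigma> :: real
  assumes "\<alpha> > 0" "\<sigma> > 0"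
  shows "(\<lambda>x. exp (\<sigma> * x) * exp (- (\<alpha> * exp x))) absolutely_integrable_on UNIV"
proof -
  have "(\<lambda>x. norm (exp (of_real \<sigma> * of_real x) * exp (- (of_real \<alpha> * of_real (exp x) :: complex))))
    absolutely_integrable_on UNIV"
    by (intro absolutely_integrable_norm[unfolded o_def] Gamma_integral_exp_of_real) (use assms in auto)
  then show ?thesis
    by (simp add: norm_mult)
qed

text \<open>Both sides are holomorphic in the scale \<open>a\<close> on the right half-plane and
  agree on the positive reals, so the identity theorem applies.\<close>

lemma Gamma_integral_exp:
  fixes a s :: complex
  assumes a: "Re a > 0" and s: "Re s > 0"
  shows "(\<lambda>x. exp (s * of_real x) * exp (- (a * of_real (exp x)))) absolutely_integrable_on UNIV"
    and "integral UNIV (\<lambda>x. exp (s * of_real x) * exp (- (a * of_real (exp x)))) = Gamma s * a powr (- s)"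
proof -
  let ?w = "\<lambda>x. exp (s * of_real x)" and ?c = "\<lambda>x. - complex_of_real (exp x)"
  have ei: "exp_integrable UNIV ?w ?c z" if z: "Re z > 0" for z
    unfolding exp_integrable_def
  proof (intro conjI exI)
    \<comment> \<open>Since \<open>norm (?c x)\<close> is \<open>exp x\<close>, half of the decay
      rate serves as the margin and the other half still gives convergence.\<close>
    show "0 < Re z / 2" using z by simp
    have "exp (Re s * x) * exp (- (Re z / 2 * exp x))
        = norm (?w x * exp (z * ?c x)) * exp (Re z / 2 * norm (?c x))" for x
    proof -
      have "exp (- (Re z / 2 * exp x)) = exp (- (Re z * exp x)) * exp (Re z / 2 * exp x)"
        unfolding exp_add[symmetric] by (simp add: field_simps)
      then show ?thesis
        by (simp add: norm_mult)
    qed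
    then show "(\<lambda>x. norm (?w x * exp (z * ?c x)) * exp (Re z / 2 * norm (?c x))) integrable_on UNIV"
      using integrable_exp_minus_exp[of "Re z / 2" "Re s"] z s
      by (simp add: absolutely_integrable_on_def)
  qed (auto intro!: continuous_intros)
  show "(\<lambda>x. exp (s * of_real x) * exp (- (a * of_real (exp x)))) absolutely_integrable_on UNIV"
    using exp_moment_absolutely_integrable[OF ei[OF a], of 0] by simp
  define h where "h = (\<lambda>z. exp_moment UNIV ?w ?c 0 z - Gamma s * z powr (- s))"
  have "h a = 0"
  proof (rule analytic_continuation[where f = h and S = "{z. Re z > 0}"
        and U = "complex_of_real ` {0<..}" and \<xi> = 1])
    have "exp_moment UNIV ?w ?c 0 holomorphic_on {z. Re z > 0}"
      by (rule exp_moment_holomorphic) (use ei in simp)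
    then show "h holomorphic_on {z. Re z > 0}"
      unfolding h_def by (intro holomorphic_intros) (auto simp: complex_nonpos_Reals_iff)
    show "connected {z. Re z > 0}"
      by (intro convex_connected convex_halfspace_Re_gt)
    show "1 islimpt complex_of_real ` {0<..}"
      unfolding islimpt_sequential
    proof (intro exI[of _ "\<lambda>n. complex_of_real (1 + inverse (real (Suc n)))"] conjI allI)
      have "(\<lambda>n. 1 + inverse (real (Suc n))) \<longlonglongrightarrow> 1 + 0"
        by (intro tendsto_add tendsto_const LIMSEQ_inverse_real_of_nat)
      from tendsto_of_real[OF this]
      show "(\<lambda>n. complex_of_real (1 + inverse (real (Suc n)))) \<longlonglongrightarrow> 1"
        by (simp only: add_0_right of_real_1)
      fix n
      have "1 + inverse (real (Suc n)) \<in> {0<..}" "1 + inverse (real (Suc n)) \<noteq> 1"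
        by (simp_all add: add_pos_pos)
      then show "complex_of_real (1 + inverse (real (Suc n))) \<in> complex_of_real ` {0<..} - {1}"
        using of_real_eq_1_iff[where 'a = complex] by blast
    qed
    show "h z = 0" if "z \<in> complex_of_real ` {0<..}" for z
      using that Gamma_integral_exp_of_real(2)[OF _ s] by (auto simp: h_def exp_moment_def)
  qed (use a in \<open>auto simp: open_halfspace_Re_gt\<close>)
  then show "integral UNIV (\<lambda>x. exp (s * of_real x) * exp (- (a * of_real (exp x)))) = Gamma s * a powr (- s)"
    by (simp add: h_def exp_moment_def)
qed

text \<open>Doubly exponential decay of the weight beats \<open>exp (\<sigma> * x)\<close> for every
  \<sigma>, so with an exponent of at most linear growth every \<open>z\<close> is
  admissible.\<close>

lemma exp_integrable_tail:
  assumes w: "continuous_on {0..} w" and c: "continuous_on {0..} c"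
    and wle: "\<And>x. x \<ge> 0 \<Longrightarrow> norm (w x) \<le> C * exp (- (\<alpha> * exp x))" and \<alpha>: "\<alpha> > 0"
    and cle: "\<And>x. x \<ge> 0 \<Longrightarrow> norm (c x) \<le> x + M"
  shows "exp_integrable {0..} w c z"
  unfolding exp_integrable_def
proof (intro conjI exI)
  let ?f = "\<lambda>x. norm (w x * exp (z * c x)) * exp (1 * norm (c x))"
  \<comment> \<open>Here \<open>norm z\<close> comes from \<open>exp (z * c x)\<close> and the 1 is
    the chosen margin.\<close>
  let ?\<sigma> = "norm z + 1"
  let ?g = "\<lambda>x. C * exp (?\<sigma> * M) * (exp (?\<sigma> * x) * exp (- (\<alpha> * exp x)))"
  have "(\<lambda>x. of_real (?f x) :: complex) absolutely_integrable_on {0..}"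
  proof (rule continuous_dominated_absolutely_integrable)
    show "continuous_on {0..} (\<lambda>x. of_real (?f x) :: complex)"
      by (intro continuous_intros w c)
    have "(\<lambda>x. exp (?\<sigma> * x) * exp (- (\<alpha> * exp x))) absolutely_integrable_on {0..}"
      by (rule set_integrable_subset[OF integrable_exp_minus_exp[OF \<alpha>]]) (auto simp: add_nonneg_pos)
    then show "?g integrable_on {0..}"
      by (intro integrable_on_mult_right) (simp add: absolutely_integrable_on_def)
    fix x :: real assume "x \<in> {0..}"
    then have x: "x \<ge> 0" by simp
    have "?f x = norm (w x) * (norm (exp (z * c x)) * exp (norm (c x)))"
      by (simp add: norm_mult)
    also have "\<dots> \<le> norm (w x) * (exp (norm (z * c x)) * exp (norm (c x)))"
      by (intro mult_left_mono mult_right_mono norm_exp) auto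
    also have "\<dots> = norm (w x) * exp (?\<sigma> * norm (c x))"
      by (simp add: norm_mult ring_distribs exp_add)
    also have "\<dots> \<le> norm (w x) * exp (?\<sigma> * (x + M))"
      using cle[OF x] by (intro mult_left_mono) (auto intro!: mult_left_mono add_nonneg_nonneg)
    also have "\<dots> \<le> (C * exp (- (\<alpha> * exp x))) * exp (?\<sigma> * (x + M))"
      by (intro mult_right_mono wle x) auto
    also have "\<dots> = ?g x"
      by (simp add: ring_distribs exp_add mult_ac)
    finally show "norm (of_real (?f x) :: complex) \<le> ?g x"
      by (simp only: norm_of_real abs_mult abs_norm_cancel abs_exp_cancel)
  qed auto
  from absolutely_integrable_linear[OF this bounded_linear_Re] show "?f integrable_on {0..}"
    by (simp add: o_def absolutely_integrable_on_def)
qed (use w c in auto)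

text \<open>After reflection to the positive half-line, the integral over [0, N] is elementary; it
  tends to 1/q because \<open>exp (- q)\<close> lies inside the unit disc.\<close>

lemma exp_integral_atMost_0:
  fixes q :: complex
  assumes q: "Re q > 0"
  shows "(\<lambda>x. exp (q * of_real x)) absolutely_integrable_on {..0::real}"
    and "integral {..0::real} (\<lambda>x. exp (q * of_real x)) = 1 / q"
proof -
  let ?f = "\<lambda>x::real. exp (- q * of_real x)"
  have g: "(\<lambda>x. exp (- Re q * x)) integrable_on {0..}"
    using has_integral_exp_minus_to_infinity[OF q, of 0] by blast
  have f: "?f absolutely_integrable_on {0..}"
    by (rule continuous_dominated_absolutely_integrable[OF _ _ g])
       (auto intro!: continuous_intros)
  have "(\<lambda>N. integral {0..} (\<lambda>x. if x \<in> {0..real N} then ?f x else 0)) \<longlonglongrightarrow> integral {0..} ?f"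
  proof (rule dominated_convergence)
    show "(\<lambda>x. if x \<in> {0..real N} then ?f x else 0) integrable_on {0..}" for N
      by (subst integrable_restrict_Int)
         (auto intro!: integrable_continuous_interval continuous_intros simp: Int_absorb2)
    show "(\<lambda>x. exp (- Re q * x)) integrable_on {0..}" by (rule g)
    show "(\<lambda>N. if x \<in> {0..real N} then ?f x else 0) \<longlonglongrightarrow> ?f x" if "x \<in> {0..}" for x
    proof (rule tendsto_eventually)
      obtain N0 where "x \<le> real N0" using real_arch_simple by blast
      then show "\<forall>\<^sub>F N in sequentially. (if x \<in> {0..real N} then ?f x else 0) = ?f x"
        using that by (intro eventually_sequentiallyI[of N0]) auto
    qed
  qed auto
  moreover have "integral {0..} (\<lambda>x. if x \<in> {0..real N} then ?f x else 0) = (1 - exp (- q) ^ N) / q" for N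
  proof -
    have "(?f has_integral (- ?f N / q - (- ?f 0 / q))) {0..real N}"
    proof (intro fundamental_theorem_of_calculus)
      fix x
      have "((\<lambda>z. - exp (- q * z) / q) has_field_derivative exp (- q * of_real x)) (at (of_real x))"
        using q by (auto intro!: derivative_eq_intros)
      then show "((\<lambda>x. - ?f x / q) has_vector_derivative ?f x) (at x within {0..real N})"
        by (intro has_vector_derivative_real_field)
    qed auto
    moreover have "integral {0..} (\<lambda>x. if x \<in> {0..real N} then ?f x else 0) = integral {0..real N} ?f"
      by (subst integral_restrict_Int) (simp add: Int_absorb2)
    moreover have "?f N = exp (- q) ^ N"
      by (simp flip: exp_of_nat_mult add: mult.commute)
    ultimately show ?thesis
      by (simp add: integral_unique diff_divide_distrib)
  qed
  moreover have "(\<lambda>N. (1 - exp (- q) ^ N) / q) \<longlonglongrightarrow> (1 - 0) / q"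
    using q by (intro tendsto_intros LIMSEQ_power_zero) auto
  ultimately have I: "integral {0..} ?f = 1 / q"
    by (metis (no_types, lifting) LIMSEQ_unique ext diff_zero)
  have im: "uminus ` {..0} = {0::real..}"
    by simp
  note cov = absolutely_integrable_change_of_variables_complex[of "{..0}" uminus "\<lambda>_. -1" ?f, unfolded im]
  have "(uminus has_field_derivative - 1) (at x within {..0})" for x :: real
    by (auto intro!: derivative_eq_intros)
  with cov f I show "(\<lambda>x. exp (q * of_real x)) absolutely_integrable_on {..0::real}"
    "integral {..0::real} (\<lambda>x. exp (q * of_real x)) = 1 / q"
    by auto
qed

section \<open>Hankel's and Schlaefli's integrals\<close>

text \<open>With q = k - p this has the same denominator as \<open>exp_integral_atMost_0\<close>,
  which is why the circle and the segment give proportional series.\<close>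

lemma integral_exp_i:
  fixes q :: complex
  assumes "q \<noteq> 0"
  shows "integral {-pi..pi} (\<lambda>x. exp (\<i> * q * of_real x)) = 2 * sin (of_real pi * q) / q"
proof -
  let ?f = "\<lambda>x::real. exp (\<i> * q * of_real x)"
  have "(?f has_integral (?f pi / (\<i> * q) - ?f (- pi) / (\<i> * q))) {-pi..pi}"
  proof (intro fundamental_theorem_of_calculus)
    fix x
    have "((\<lambda>z. exp (\<i> * q * z) / (\<i> * q)) has_field_derivative exp (\<i> * q * of_real x)) (at (of_real x))"
      using assms by (auto intro!: derivative_eq_intros)
    then show "((\<lambda>x. ?f x / (\<i> * q)) has_vector_derivative ?f x) (at x within {-pi..pi})"
      by (intro has_vector_derivative_real_field)
  qed auto
  then show ?thesis
    using assms by (simp add: integral_unique sin_exp_eq field_simps)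
qed

lemma sin_pi_of_nat_add:
  "sin (of_real pi * (of_nat k + z)) = (-1) ^ k * sin (of_real pi * z :: complex)"
proof (induction k)
  case (Suc k)
  have "sin (of_real pi * (of_nat (Suc k) + z)) = sin (of_real pi * (of_nat k + z) + of_real pi)"
    by (simp add: algebra_simps)
  also have "\<dots> = - sin (of_real pi * (of_nat k + z))"
    by (simp add: sin_add flip: sin_of_real cos_of_real)
  finally show ?case using Suc by simp
qed simp

lemma exp_integrable_minus_exp:
  assumes "Re a > 0"
  shows "exp_integrable {0..} (\<lambda>x. exp (- (a * of_real (exp x)))) (\<lambda>x. - of_real x) z"
  by (rule exp_integrable_tail[where C = 1 and \<alpha> = "Re a" and M = 0])
     (use assms in \<open>auto intro!: continuous_intros\<close>)

text \<open>The first moment is the unit circle w = exp(ix). The second is the cut w = -exp(x)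
  outside it, whose two sides have arguments pi and -pi and combine to the sine factor.
  \<open>Re p < 0\<close> makes the integral over the segment inside the circle converge.\<close>

lemma hankel_rGamma_left_half_plane:
  assumes a: "Re a > 0" and p: "Re p < 0"
  shows "exp_moment {-pi..pi} (\<lambda>x. exp (a * exp (\<i> * of_real x))) (\<lambda>x. - \<i> * of_real x) 0 p / (2 * of_real pi)
    - sin (of_real pi * p) / of_real pi *
      exp_moment {0..} (\<lambda>x. exp (- (a * of_real (exp x)))) (\<lambda>x. - of_real x) 0 p
    = a powr p * rGamma (p + 1)"
proof -
  let ?T = "exp_moment {0..} (\<lambda>x. exp (- (a * of_real (exp x)))) (\<lambda>x. - of_real x) 0 p"
  let ?C = "exp_moment {-pi..pi} (\<lambda>x. exp (a * exp (\<i> * of_real x))) (\<lambda>x. - \<i> * of_real x) 0 p"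
  let ?F = "\<lambda>x::real. exp (- p * of_real x) * exp (- (a * of_real (exp x)))"
  let ?L = "integral {..0} ?F"
  have p': "Re (- p) > 0" using p by simp
  have F: "?F absolutely_integrable_on A" if "A \<in> sets lebesgue" for A
    using set_integrable_subset[OF Gamma_integral_exp(1)[OF a p'] that] by simp
  \<comment> \<open>Euler's integral over the whole line splits at x = 0: \<open>?L\<close> belongs
    to exp(x) in (0,1), \<open>?T\<close> to the tail beyond 1.\<close>
  have "{..0} \<inter> {0..} = {0::real}" by auto
  then have "integral ({..0} \<union> {0..}) ?F = ?L + integral {0..} ?F"
    using F[of "{..0}"] F[of "{0..}"] by (intro integral_Un) (auto simp: absolutely_integrable_on_def)
  also have "integral {0..} ?F = ?T"
    by (simp add: exp_moment_def mult.commute)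
  also have "{..0} \<union> {0..} = (UNIV :: real set)" by auto
  finally have split: "?L + ?T = Gamma (- p) * a powr p"
    using Gamma_integral_exp(2)[OF a p'] by simp
  have pk: "of_nat k - p \<noteq> 0" for k
    using p by (auto simp: complex_eq_iff)

  have "(\<lambda>k. (- a) ^ k / fact k * integral {..0} (\<lambda>x::real. exp (- p * of_real x) * of_real (exp x) ^ k)) sums
    integral {..0} (\<lambda>x::real. exp (- p * of_real x) * exp (- a * of_real (exp x)))"
    by (rule integral_exp_sums)
       (use exp_integral_atMost_0(1)[OF p'] in \<open>auto intro!: continuous_intros\<close>)
  moreover have "integral {..0} (\<lambda>x::real. exp (- p * of_real x) * of_real (exp x) ^ k) = 1 / (of_nat k - p)" for k
  proof -
    have "(\<lambda>x::real. exp (- p * of_real x) * of_real (exp x) ^ k) = (\<lambda>x. exp ((of_nat k - p) * of_real x))"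
      by (auto simp: fun_eq_iff exp_of_real[symmetric] ring_distribs exp_add[symmetric] simp flip: exp_of_nat_mult)
    then show ?thesis
      using exp_integral_atMost_0(2)[of "of_nat k - p"] p by simp
  qed
  ultimately have L: "(\<lambda>k. (- a) ^ k / fact k * (1 / (of_nat k - p))) sums ?L"
    by (simp only: mult_minus_left)

  have "(\<lambda>k. a ^ k / fact k * integral {-pi..pi} (\<lambda>x::real. exp (- \<i> * p * of_real x) * exp (\<i> * of_real x) ^ k)) sums
    integral {-pi..pi} (\<lambda>x::real. exp (- \<i> * p * of_real x) * exp (a * exp (\<i> * of_real x)))"
    by (rule integral_exp_sums)
       (auto intro!: continuous_intros absolutely_integrable_continuous_real)
  also have "integral {-pi..pi} (\<lambda>x::real. exp (- \<i> * p * of_real x) * exp (a * exp (\<i> * of_real x))) = ?C"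
    by (simp add: exp_moment_def mult_ac)
  also have "(\<lambda>k. a ^ k / fact k * integral {-pi..pi} (\<lambda>x::real. exp (- \<i> * p * of_real x) * exp (\<i> * of_real x) ^ k))
    = (\<lambda>k. - 2 * sin (of_real pi * p) * ((- a) ^ k / fact k * (1 / (of_nat k - p))))"
  proof
    fix k
    have "(\<lambda>x::real. exp (- \<i> * p * of_real x) * exp (\<i> * of_real x) ^ k)
        = (\<lambda>x. exp (\<i> * (of_nat k - p) * of_real x))"
      by (auto simp: fun_eq_iff algebra_simps exp_add[symmetric] simp flip: exp_of_nat_mult)
    then have "integral {-pi..pi} (\<lambda>x::real. exp (- \<i> * p * of_real x) * exp (\<i> * of_real x) ^ k)
      = 2 * sin (of_real pi * (of_nat k - p)) / (of_nat k - p)"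
      using integral_exp_i[OF pk[of k]] by simp
    also have "sin (of_real pi * (of_nat k - p)) = - ((-1) ^ k * sin (of_real pi * p))"
      using sin_pi_of_nat_add[of k "- p"] by simp
    finally show "a ^ k / fact k * integral {-pi..pi} (\<lambda>x::real. exp (- \<i> * p * of_real x) * exp (\<i> * of_real x) ^ k)
      = - 2 * sin (of_real pi * p) * ((- a) ^ k / fact k * (1 / (of_nat k - p)))"
      by (simp add: power_minus[of a])
  qed
  \<comment> \<open>The two series agree term by term up to a constant factor, so the circle can be
    traded for the segment and joined to the tail.\<close>
  finally have "?C = - 2 * sin (of_real pi * p) * ?L"
    using sums_mult[OF L] sums_unique2 by blast
  then have "?C / (2 * of_real pi) - sin (of_real pi * p) / of_real pi * ?T
      = - (sin (of_real pi * p) / of_real pi) * (?L + ?T)"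
    by (simp add: field_simps)
  \<comment> \<open>The reflection formula at -p turns the sine into the factor wanted,
    \<open>rGamma (p + 1)\<close>, and one that cancels \<open>Gamma (- p)\<close>.\<close>
  also have "- (sin (of_real pi * p) / of_real pi) = rGamma (- p) * rGamma (p + 1)"
    using rGamma_reflection_complex[of "- p"] by (simp add: add.commute)
  also have "rGamma (- p) * rGamma (p + 1) * (?L + ?T) = (rGamma (- p) * Gamma (- p)) * (a powr p * rGamma (p + 1))"
    unfolding split by (simp only: mult_ac)
  finally have *: "?C / (2 * of_real pi) - sin (of_real pi * p) / of_real pi * ?T
      = (rGamma (- p) * Gamma (- p)) * (a powr p * rGamma (p + 1))" .
  \<comment> \<open>The cancellation is valid only off the poles of Gamma, which
    \<open>Re (- p) > 0\<close> excludes.\<close>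
  have "- p \<notin> \<int>\<^sub>\<le>\<^sub>0"
  proof
    assume "- p \<in> \<int>\<^sub>\<le>\<^sub>0"
    then obtain m :: int where "- p = of_int m" "m \<le> 0"
      by (elim nonpos_Ints_cases)
    moreover from this have "Re (- p) = of_int m"
      by (simp only: complex_Re_of_int)
    ultimately show False using p' by simp
  qed
  then have "rGamma (- p) * Gamma (- p) = 1"
    by (simp add: rGamma_inverse_Gamma Gamma_eq_zero_iff)
  with * show ?thesis by simp
qed

text \<open>With the segment gone, every remaining integral converges for all \<open>p\<close>; both
  sides are entire in \<open>p\<close> and agree on a half-plane.\<close>

lemma hankel_rGamma:
  assumes a: "Re a > 0"
  shows "exp_moment {-pi..pi} (\<lambda>x. exp (a * exp (\<i> * of_real x))) (\<lambda>x. - \<i> * of_real x) 0 p / (2 * of_real pi)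
    - sin (of_real pi * p) / of_real pi *
      exp_moment {0..} (\<lambda>x. exp (- (a * of_real (exp x)))) (\<lambda>x. - of_real x) 0 p
    = a powr p * rGamma (p + 1)"
proof (rule analytic_continuation_open[where s = "{z. Re z < 0}" and s' = UNIV and z = p])
  show "{z. Re z < 0} \<noteq> {}" by (auto intro!: exI[of _ "-1"])
  have "exp_moment {-pi..pi} (\<lambda>x. exp (a * exp (\<i> * of_real x))) (\<lambda>x. - \<i> * of_real x) 0 holomorphic_on UNIV"
    by (intro exp_moment_holomorphic exp_integrable_compact continuous_intros)
  moreover have "exp_moment {0..} (\<lambda>x. exp (- (a * of_real (exp x)))) (\<lambda>x. - of_real x) 0 holomorphic_on UNIV"
    by (intro exp_moment_holomorphic exp_integrable_minus_exp a)
  ultimately show "(\<lambda>p. exp_moment {-pi..pi} (\<lambda>x. exp (a * exp (\<i> * of_real x))) (\<lambda>x. - \<i> * of_real x) 0 p / (2 * of_real pi)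
    - sin (of_real pi * p) / of_real pi *
      exp_moment {0..} (\<lambda>x. exp (- (a * of_real (exp x)))) (\<lambda>x. - of_real x) 0 p) holomorphic_on UNIV"
    by (intro holomorphic_intros) auto
  show "(\<lambda>p. a powr p * rGamma (p + 1)) holomorphic_on UNIV"
    using a by (auto intro!: holomorphic_intros)
  show "exp_moment {-pi..pi} (\<lambda>x. exp (a * exp (\<i> * of_real x))) (\<lambda>x. - \<i> * of_real x) 0 z / (2 * of_real pi)
    - sin (of_real pi * z) / of_real pi *
      exp_moment {0..} (\<lambda>x. exp (- (a * of_real (exp x)))) (\<lambda>x. - of_real x) 0 z
    = a powr z * rGamma (z + 1)" if "z \<in> {z. Re z < 0}" for z
    using that by (intro hankel_rGamma_left_half_plane a) simp
qed (auto simp: open_halfspace_Re_lt)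

text \<open>Hankel's formula is applied with a = t/2 and p = k + nu. Summing (-a)^k / k! times
  w^(-k) under the integral gives exp(a (w - 1/w)), which is exp(i t sin x) on the circle and exp(-t
  sinh x) on the cut.\<close>

lemma bessel_J_schlaefli:
  assumes t: "Re t > 0"
  shows "bessel_J \<nu> t =
    exp_moment {-pi..pi} (\<lambda>x. exp (\<i> * t * of_real (sin x))) (\<lambda>x. - \<i> * of_real x) 0 \<nu> / (2 * of_real pi)
    - sin (of_real pi * \<nu>) / of_real pi *
      exp_moment {0..} (\<lambda>x. exp (- t * of_real (sinh x))) (\<lambda>x. - of_real x) 0 \<nu>"
proof -
  define a where "a = t / 2"
  have a: "Re a > 0" using t by (simp add: a_def)
  then have a0: "a \<noteq> 0" by auto
  let ?wC = "\<lambda>x. exp (a * exp (\<i> * of_real x))" and ?wT = "\<lambda>x. exp (- (a * of_real (exp x)))"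
  let ?C = "exp_moment {-pi..pi} ?wC (\<lambda>x. - \<i> * of_real x) 0"
  let ?T = "exp_moment {0..} ?wT (\<lambda>x. - of_real x) 0"

  have "(\<lambda>k. (- a) ^ k / fact k *
      integral {-pi..pi} (\<lambda>x. ?wC x * exp (\<nu> * (- \<i> * of_real x)) * exp (- \<i> * of_real x) ^ k)) sums
    integral {-pi..pi} (\<lambda>x. ?wC x * exp (\<nu> * (- \<i> * of_real x)) * exp (- a * exp (- \<i> * of_real x)))"
    by (rule integral_exp_sums)
       (auto intro!: continuous_intros absolutely_integrable_continuous_real)
  also have "(\<lambda>k. integral {-pi..pi} (\<lambda>x. ?wC x * exp (\<nu> * (- \<i> * of_real x)) * exp (- \<i> * of_real x) ^ k))
      = (\<lambda>k. ?C (of_nat k + \<nu>))"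
    by (simp add: exp_moment_def algebra_simps exp_add[symmetric] flip: exp_of_nat_mult)
  also have "(\<lambda>x. ?wC x * exp (\<nu> * (- \<i> * of_real x)) * exp (- a * exp (- \<i> * of_real x)))
      = (\<lambda>x. exp (\<i> * t * of_real (sin x)) * exp (\<nu> * (- \<i> * of_real x)))"
  proof
    fix x :: real
    have "a * exp (\<i> * of_real x) - a * exp (- \<i> * of_real x) = \<i> * t * of_real (sin x)"
      by (simp add: a_def sin_exp_eq field_simps flip: sin_of_real)
    then have "exp (\<i> * t * of_real (sin x)) = ?wC x * exp (- a * exp (- \<i> * of_real x))"
      by (simp flip: exp_add)
    then show "?wC x * exp (\<nu> * (- \<i> * of_real x)) * exp (- a * exp (- \<i> * of_real x))
      = exp (\<i> * t * of_real (sin x)) * exp (\<nu> * (- \<i> * of_real x))"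
      by (simp only: mult_ac)
  qed
  finally have 1: "(\<lambda>k. (- a) ^ k / fact k * ?C (of_nat k + \<nu>)) sums
    exp_moment {-pi..pi} (\<lambda>x. exp (\<i> * t * of_real (sin x))) (\<lambda>x. - \<i> * of_real x) 0 \<nu>"
    by (simp add: exp_moment_def)

  \<comment> \<open>On the cut w is negative, so the series is that of exp(a exp(-x)), with
    \<open>a\<close> in place of -a.\<close>
  have "(\<lambda>k. a ^ k / fact k *
      integral {0..} (\<lambda>x. ?wT x * exp (\<nu> * (- of_real x)) * of_real (exp (- x)) ^ k)) sums
    integral {0..} (\<lambda>x. ?wT x * exp (\<nu> * (- of_real x)) * exp (a * of_real (exp (- x))))"
    by (rule integral_exp_sums)
       (use exp_moment_absolutely_integrable[OF exp_integrable_minus_exp[OF a], of 0 \<nu>] in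
         \<open>auto intro!: continuous_intros\<close>)
  also have "(\<lambda>k. integral {0..} (\<lambda>x. ?wT x * exp (\<nu> * (- of_real x)) * of_real (exp (- x)) ^ k))
      = (\<lambda>k. ?T (of_nat k + \<nu>))"
    by (simp add: exp_moment_def algebra_simps exp_add[symmetric] exp_of_real[symmetric]
        flip: exp_of_nat_mult)
  also have "(\<lambda>x. ?wT x * exp (\<nu> * (- of_real x)) * exp (a * of_real (exp (- x))))
      = (\<lambda>x. exp (- t * of_real (sinh x)) * exp (\<nu> * (- of_real x)))"
  proof
    fix x :: real
    have "- (a * of_real (exp x)) + a * of_real (exp (- x)) = - t * of_real (sinh x)"
      by (simp add: a_def sinh_field_def field_simps)
    then have "exp (- t * of_real (sinh x)) = ?wT x * exp (a * of_real (exp (- x)))"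
      by (simp flip: exp_add)
    then show "?wT x * exp (\<nu> * (- of_real x)) * exp (a * of_real (exp (- x)))
      = exp (- t * of_real (sinh x)) * exp (\<nu> * (- of_real x))"
      by (simp only: mult_ac)
  qed
  finally have 2: "(\<lambda>k. a ^ k / fact k * ?T (of_nat k + \<nu>)) sums
    exp_moment {0..} (\<lambda>x. exp (- t * of_real (sinh x))) (\<lambda>x. - of_real x) 0 \<nu>"
    by (simp add: exp_moment_def)

  have "(-1) ^ k / fact k * rGamma (of_nat k + \<nu> + 1) * (t / 2) powr (2 * of_nat k + \<nu>)
    = (- a) ^ k / fact k * ?C (of_nat k + \<nu>) / (2 * of_real pi)
      - sin (of_real pi * \<nu>) / of_real pi * (a ^ k / fact k * ?T (of_nat k + \<nu>))" for k
  proof -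
    \<comment> \<open>The factor \<open>a ^ k\<close> belongs to the exponential series, the
      remaining power to Hankel's formula.\<close>
    have "a powr (2 * of_nat k + \<nu>) = a ^ k * a powr (of_nat k + \<nu>)"
    proof -
      have "2 * of_nat k + \<nu> = of_nat k + (of_nat k + \<nu>)" by simp
      then show ?thesis
        using a0 by (simp only: powr_add powr_nat' simp_thms)
    qed
    then have "(-1) ^ k / fact k * rGamma (of_nat k + \<nu> + 1) * (t / 2) powr (2 * of_nat k + \<nu>)
      = (- a) ^ k / fact k * (a powr (of_nat k + \<nu>) * rGamma (of_nat k + \<nu> + 1))"
      by (simp add: power_minus[of a] a_def[symmetric])
    also have "\<dots> = (- a) ^ k / fact k * (?C (of_nat k + \<nu>) / (2 * of_real pi)
        - sin (of_real pi * (of_nat k + \<nu>)) / of_real pi * ?T (of_nat k + \<nu>))"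
      by (subst hankel_rGamma[OF a]) (rule refl)
    \<comment> \<open>One sign (-1)^k comes from the Bessel series, the other from shifting the sine
      by k pi; they cancel in the tail.\<close>
    also have "\<dots> = (- a) ^ k / fact k * ?C (of_nat k + \<nu>) / (2 * of_real pi)
      - ((-1) ^ k * (-1) ^ k) * (sin (of_real pi * \<nu>) / of_real pi * (a ^ k / fact k * ?T (of_nat k + \<nu>)))"
      unfolding sin_pi_of_nat_add by (simp add: power_minus[of a] field_simps)
    finally show ?thesis
      by (simp flip: power_mult_distrib)
  qed
  then show ?thesis
    unfolding bessel_J_def
    using sums_unique[OF sums_diff[OF sums_divide[OF 1, of "2 * of_real pi"]
        sums_mult[OF 2, of "sin (of_real pi * \<nu>) / of_real pi"]]]
    by simp
qed


section \<open>Half-line integrals with weight exp(-t sinh x)\<close>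

lemma exp_integrable_sinh:
  assumes t: "Re t > 0" and c: "continuous_on {0..} c" "\<And>x. x \<ge> 0 \<Longrightarrow> norm (c x) \<le> x + M"
  shows "exp_integrable {0..} (\<lambda>x. exp (- t * of_real (sinh x))) c z"
\<comment> \<open>Both constants come from sinh x \<ge> (exp x - 1)/2 for x \<ge> 0.\<close>
proof (rule exp_integrable_tail[where C = "exp (Re t / 2)" and \<alpha> = "Re t / 2" and M = M])
  fix x :: real assume "x \<ge> 0"
  then have "(exp x - 1) / 2 \<le> sinh x"
    by (simp add: sinh_field_def field_simps)
  then have "Re t * ((exp x - 1) / 2) \<le> Re t * sinh x"
    using t by (intro mult_left_mono) auto
  then have "- (Re t * sinh x) \<le> Re t / 2 + - (Re t / 2 * exp x)"
    by (simp add: field_simps)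
  then show "norm (exp (- t * of_real (sinh x))) \<le> exp (Re t / 2) * exp (- (Re t / 2 * exp x))"
    unfolding exp_add[symmetric] by simp
qed (use t c in \<open>auto intro!: continuous_intros\<close>)

section \<open>The Bessel function of the second kind\<close>

text \<open>The integral formula for the \<open>n\<close>-th derivative, with all trigonometric functions split into
  exponentials: differentiating in \<open>z\<close> then just increases \<open>n\<close>.\<close>
definition bessel_Y_integral :: "complex \<Rightarrow> nat \<Rightarrow> complex \<Rightarrow> complex" where
  "bessel_Y_integral t n z = 1 / of_real pi *
    ((exp_moment {0..pi} (\<lambda>x. exp (\<i> * t * of_real (sin x))) (\<lambda>x. - \<i> * of_real x) n z
      - exp_moment {0..pi} (\<lambda>x. exp (- \<i> * t * of_real (sin x))) (\<lambda>x. \<i> * of_real x) n z) / (2 * \<i>)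
    - (exp_moment {0..} (\<lambda>x. exp (- t * of_real (sinh x))) of_real n z
      + (exp_moment {0..} (\<lambda>x. exp (- t * of_real (sinh x))) (\<lambda>x. \<i> * of_real pi - of_real x) n z
        + exp_moment {0..} (\<lambda>x. exp (- t * of_real (sinh x))) (\<lambda>x. - \<i> * of_real pi - of_real x) n z) / 2))"

lemma norm_i_pi_minus_le:
  assumes "x \<ge> 0"
  shows "norm (\<i> * of_real pi - of_real x) \<le> x + pi" "norm (- \<i> * of_real pi - of_real x) \<le> x + pi"
  using norm_triangle_ineq4[of "\<i> * of_real pi" "of_real x"]
    norm_triangle_ineq4[of "- \<i> * of_real pi" "of_real x"] assms
  by (simp_all add: norm_mult)

lemma exp_integrable_sinh_exponents:
  assumes "Re t > 0"
  shows "exp_integrable {0..} (\<lambda>x. exp (- t * of_real (sinh x))) of_real z"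
    and "exp_integrable {0..} (\<lambda>x. exp (- t * of_real (sinh x))) (\<lambda>x. - of_real x) z"
    and "exp_integrable {0..} (\<lambda>x. exp (- t * of_real (sinh x))) (\<lambda>x. \<i> * of_real pi - of_real x) z"
    and "exp_integrable {0..} (\<lambda>x. exp (- t * of_real (sinh x))) (\<lambda>x. - \<i> * of_real pi - of_real x) z"
  \<comment> \<open>The bound x + pi is needed for the two exponents with imaginary part pi or -pi
    and also covers the two real ones.\<close>
  by (intro exp_integrable_sinh[where M = pi] assms continuous_intros;
      use norm_i_pi_minus_le in auto)+

lemma bessel_Y_integral_has_field_derivative:
  assumes t: "Re t > 0"
  shows "(bessel_Y_integral t n has_field_derivative bessel_Y_integral t (Suc n) z) (at z)"
  unfolding bessel_Y_integral_def[abs_def]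
  by (rule DERIV_cmult DERIV_diff DERIV_add DERIV_cdivide exp_moment_has_field_derivative
      exp_integrable_compact exp_integrable_sinh_exponents t
      | intro continuous_intros)+

lemma integral_reflect_0_pi:
  fixes f :: "real \<Rightarrow> complex"
  assumes "f integrable_on {0..pi}"
  shows "integral {0..pi} (\<lambda>x. f (pi - x)) = integral {0..pi} f"
proof -
  have "(f has_integral integral {0..pi} f) (cbox 0 pi)"
    using assms by (simp add: integrable_integral)
  from has_integral_affinity[OF this, of "-1" pi]
  have "((\<lambda>x. f (pi - x)) has_integral integral {0..pi} f) ((\<lambda>x. pi - x) ` {0..pi})"
    by (simp add: algebra_simps)
  moreover have "(\<lambda>x. pi - x) ` {0..pi} = {0..pi}"
    by simp
  ultimately show ?thesis
    by (simp add: integral_unique)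
qed

text \<open>The tails in Schlaefli's integral already carry the factor sin(pi nu). For the circle it
  appears after reflecting x to pi - x, which fixes sin x and relates the half-circle integrals at
  -nu and nu by factors exp(i pi nu) and exp(-i pi nu). The sine then cancels.\<close>

lemma bessel_Y_quotient_eq_integral:
  assumes t: "Re t > 0" and \<nu>: "\<nu> \<notin> \<int>"
  shows "bessel_Y_quotient \<nu> t = bessel_Y_integral t 0 \<nu>"
proof -
  let ?A = "exp_moment {-pi..pi} (\<lambda>x. exp (\<i> * t * of_real (sin x))) (\<lambda>x. - \<i> * of_real x) 0"
  let ?M1 = "exp_moment {0..pi} (\<lambda>x. exp (\<i> * t * of_real (sin x))) (\<lambda>x. - \<i> * of_real x) 0"
  let ?M2 = "exp_moment {0..pi} (\<lambda>x. exp (- \<i> * t * of_real (sin x))) (\<lambda>x. \<i> * of_real x) 0"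
  let ?w = "\<lambda>x. exp (- t * of_real (sinh x))"
  let ?T = "exp_moment {0..} ?w (\<lambda>x. - of_real x) 0"
  let ?e = "exp (\<i> * (of_real pi * \<nu>))"
  let ?s = "sin (of_real pi * \<nu>)" and ?c = "cos (of_real pi * \<nu>)"
  \<comment> \<open>The lower half-circle is folded onto [0, pi] by x to -x, because the reflection
    about pi/2 preserves only the halves.\<close>
  have A: "?A z = ?M1 z + ?M2 z" for z
  proof -
    let ?f = "\<lambda>x::real. exp (\<i> * t * of_real (sin x)) * exp (z * (- \<i> * of_real x))"
    have f: "?f integrable_on {a..b}" for a b
      by (intro integrable_continuous_interval continuous_intros)
    have "?A z = integral {-pi..0} ?f + integral {0..pi} ?f"
      using Henstock_Kurzweil_Integration.integral_combine[of "-pi" 0 pi ?f] f by (simp add: exp_moment_def)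
    also have "integral {-pi..0} ?f = ?M2 z"
      using Henstock_Kurzweil_Integration.integral_reflect_real[of 0 "-pi" ?f]
      by (simp add: exp_moment_def)
    finally show ?thesis
      by (simp add: exp_moment_def add.commute)
  qed
  have M1: "?M1 (- \<nu>) = ?e * ?M1 \<nu>"
  proof -
    let ?f = "\<lambda>x::real. exp (\<i> * t * of_real (sin x)) * exp (- \<nu> * (- \<i> * of_real x))"
    have "integral {0..pi} ?f = integral {0..pi} (\<lambda>x. ?f (pi - x))"
      by (intro integral_reflect_0_pi[symmetric] integrable_continuous_interval continuous_intros)
    also have "(\<lambda>x. ?f (pi - x)) = (\<lambda>x. ?e * (exp (\<i> * t * of_real (sin x)) * exp (\<nu> * (- \<i> * of_real x))))"
      by (simp add: fun_eq_iff algebra_simps flip: exp_add)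
    finally show ?thesis by (simp add: exp_moment_def)
  qed
  have M2: "?M2 (- \<nu>) = inverse ?e * ?M2 \<nu>"
  proof -
    let ?f = "\<lambda>x::real. exp (- \<i> * t * of_real (sin x)) * exp (- \<nu> * (\<i> * of_real x))"
    have "integral {0..pi} ?f = integral {0..pi} (\<lambda>x. ?f (pi - x))"
      by (intro integral_reflect_0_pi[symmetric] integrable_continuous_interval continuous_intros)
    also have "(\<lambda>x. ?f (pi - x)) = (\<lambda>x. inverse ?e * (exp (- \<i> * t * of_real (sin x)) * exp (\<nu> * (\<i> * of_real x))))"
      by (simp add: fun_eq_iff algebra_simps flip: exp_add exp_minus)
    finally show ?thesis by (simp add: exp_moment_def)
  qed
  have T: "?T (- \<nu>) = exp_moment {0..} ?w of_real 0 \<nu>"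
    by (simp add: exp_moment_def)
  have M4: "exp_moment {0..} ?w (\<lambda>x. \<i> * of_real pi - of_real x) 0 \<nu> = ?e * ?T \<nu>"
  proof -
    have "(\<lambda>x. ?w x * exp (\<nu> * (\<i> * of_real pi - of_real x))) = (\<lambda>x. ?e * (?w x * exp (\<nu> * (- of_real x))))"
      by (simp add: fun_eq_iff algebra_simps flip: exp_add)
    then show ?thesis by (simp add: exp_moment_def)
  qed
  have M5: "exp_moment {0..} ?w (\<lambda>x. - \<i> * of_real pi - of_real x) 0 \<nu> = inverse ?e * ?T \<nu>"
  proof -
    have "(\<lambda>x. ?w x * exp (\<nu> * (- \<i> * of_real pi - of_real x))) = (\<lambda>x. inverse ?e * (?w x * exp (\<nu> * (- of_real x))))"
      unfolding exp_minus[symmetric] exp_add[symmetric]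
      by (intro ext arg_cong[where f = exp]) (simp add: algebra_simps)
    then show ?thesis by (simp add: exp_moment_def)
  qed
  have s: "?s = (?e - inverse ?e) / (2 * \<i>)" and c: "?c = (?e + inverse ?e) / 2"
    by (simp_all add: sin_exp_eq cos_exp_eq exp_minus)
  have s0: "?s \<noteq> 0"
  proof
    assume "?s = 0"
    then obtain k :: int where "of_real pi * \<nu> = of_real (of_int k * pi)"
      by (auto simp: sin_eq_0)
    then have "\<nu> = of_int k" by simp
    with \<nu> show False by simp
  qed
  \<comment> \<open>These differences are the coefficients of \<open>?M1 \<nu>\<close> and
    \<open>?M2 \<nu>\<close> in the numerator; each is a multiple of the sine.\<close>
  have e1: "?c - ?e = - \<i> * ?s" and e2: "?c - inverse ?e = \<i> * ?s"
    unfolding s c by (simp_all add: field_simps)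
  have "?A \<nu> * ?c - ?A (- \<nu>) = (?c - ?e) * ?M1 \<nu> + (?c - inverse ?e) * ?M2 \<nu>"
    unfolding A M1 M2 by (simp add: algebra_simps)
  also have "\<dots> = ?s * ((?M1 \<nu> - ?M2 \<nu>) / \<i>)"
    unfolding e1 e2 by (simp add: algebra_simps)
  finally have AA: "?A \<nu> * ?c - ?A (- \<nu>) = ?s * ((?M1 \<nu> - ?M2 \<nu>) / \<i>)" .
  \<comment> \<open>The sine is odd, so the tail of \<open>bessel_J (- \<nu>) t\<close> enters with
    the same sign as that of \<open>bessel_J \<nu> t\<close>.\<close>
  have "bessel_J \<nu> t * ?c - bessel_J (- \<nu>) t
      = (?A \<nu> * ?c - ?A (- \<nu>)) / (2 * of_real pi) - ?s / of_real pi * (?T (- \<nu>) + ?c * ?T \<nu>)"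
    unfolding bessel_J_schlaefli[OF t] by (simp add: field_simps)
  also have "\<dots> = ?s * (1 / of_real pi * ((?M1 \<nu> - ?M2 \<nu>) / (2 * \<i>) - (?T (- \<nu>) + ?c * ?T \<nu>)))"
    unfolding AA by (simp add: field_simps)
  finally have "bessel_Y_quotient \<nu> t
      = 1 / of_real pi * ((?M1 \<nu> - ?M2 \<nu>) / (2 * \<i>) - (?T (- \<nu>) + ?c * ?T \<nu>))"
    unfolding bessel_Y_quotient_def using s0 by simp
  also have "?c * ?T \<nu> = (?e * ?T \<nu> + inverse ?e * ?T \<nu>) / 2"
    unfolding c by (simp add: field_simps)
  finally show ?thesis
    unfolding bessel_Y_integral_def M4 M5 T .
qed

text \<open>At an integer the quotient equals the integral formula on a punctured disc of radius 1,
  and the formula is continuous there, so its value is the limit.\<close>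

lemma bessel_Y_eq_integral:
  assumes t: "Re t > 0"
  shows "bessel_Y \<nu> t = bessel_Y_integral t 0 \<nu>"
proof (cases "\<nu> \<in> \<int>")
  case True
  have "(bessel_Y_integral t 0 \<longlongrightarrow> bessel_Y_integral t 0 \<nu>) (at \<nu>)"
    using DERIV_isCont[OF bessel_Y_integral_has_field_derivative[OF t]] by (simp add: isCont_def)
  moreover have "\<forall>\<^sub>F \<mu> in at \<nu>. bessel_Y_integral t 0 \<mu> = bessel_Y_quotient \<mu> t"
  proof -
    have "\<forall>\<^sub>F \<mu> in at \<nu>. \<mu> \<notin> \<int>"
      unfolding eventually_at
    proof (intro exI[of _ 1] conjI ballI impI)
      fix \<mu> :: complex assume \<mu>: "\<mu> \<noteq> \<nu> \<and> dist \<mu> \<nu> < 1"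
      show "\<mu> \<notin> \<int>"
      proof
        assume "\<mu> \<in> \<int>"
        then have "\<mu> - \<nu> \<in> \<int>" using True by simp
        then obtain k :: int where "\<mu> - \<nu> = of_int k" by (elim Ints_cases)
        moreover from this \<mu> have "k = 0" by (simp add: dist_norm) linarith
        ultimately show False using \<mu> by simp
      qed
    qed simp
    then show ?thesis
      by eventually_elim (simp add: bessel_Y_quotient_eq_integral[OF t])
  qed
  ultimately have "((\<lambda>\<mu>. bessel_Y_quotient \<mu> t) \<longlongrightarrow> bessel_Y_integral t 0 \<nu>) (at \<nu>)"
    by (rule Lim_transform_eventually)
  then have "Lim (at \<nu>) (\<lambda>\<mu>. bessel_Y_quotient \<mu> t) = bessel_Y_integral t 0 \<nu>"
    by (intro tendsto_Lim) auto
  with True show ?thesis by (simp add: bessel_Y_def)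
qed (simp add: bessel_Y_def bessel_Y_quotient_eq_integral[OF t])

section \<open>Derivatives along the real axis and the return to trigonometric form\<close>

lemma nth_derivative_bessel_Y:
  assumes t: "Re t > 0"
  shows "nth_derivative n (\<lambda>\<mu>. bessel_Y (of_real \<mu>) t) = (\<lambda>\<mu>. bessel_Y_integral t n (of_real \<mu>))"
proof (induction n)
  case 0
  then show ?case by (simp add: nth_derivative_def bessel_Y_eq_integral[OF t])
next
  case (Suc n)
  have "nth_derivative (Suc n) (\<lambda>\<mu>. bessel_Y (of_real \<mu>) t)
    = (\<lambda>x. vector_derivative (nth_derivative n (\<lambda>\<mu>. bessel_Y (of_real \<mu>) t)) (at x))"
    by (simp add: nth_derivative_def)
  also have "\<dots> = (\<lambda>\<mu>. bessel_Y_integral t (Suc n) (of_real \<mu>))"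
    unfolding Suc
    by (intro ext vector_derivative_at has_vector_derivative_real_field
        bessel_Y_integral_has_field_derivative t)
  finally show ?case .
qed

text \<open>The phase shift n pi/2 contributes the powers of -i and i which, together with x^n, are
  exactly those produced by differentiating exp(-i nu x) and exp(i nu x) in nu.\<close>

lemma sin_minus_half_pi_multiple:
  "of_real x ^ n * sin (y - of_real (\<nu> * x) - of_real (pi / 2 * real n)) =
    (exp (\<i> * y) * (- \<i> * of_real x) ^ n * exp (of_real \<nu> * (- \<i> * of_real x))
     - exp (- \<i> * y) * (\<i> * of_real x) ^ n * exp (of_real \<nu> * (\<i> * of_real x))) / (2 * \<i>)"
proof -
  have e: "exp (\<i> * of_real (pi / 2 * real n)) = \<i> ^ n"
  proof -
    have "exp (\<i> * of_real (pi / 2 * real n)) = exp (of_nat n * (\<i> * of_real (pi / 2)))"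
      by (simp add: mult_ac)
    also have "\<dots> = exp (\<i> * of_real (pi / 2)) ^ n"
      by (rule exp_of_nat_mult)
    also have "exp (\<i> * of_real (pi / 2)) = \<i>"
      by (simp only: cis_conv_exp[symmetric] cis_pi_half)
    finally show ?thesis .
  qed
  have e': "exp (- (\<i> * of_real (pi / 2 * real n))) = (- \<i>) ^ n"
    unfolding exp_minus e by (simp flip: power_inverse)
  have E1: "exp (\<i> * (y - of_real (\<nu> * x) - of_real (pi / 2 * real n)))
      = exp (\<i> * y) * exp (of_real \<nu> * (- \<i> * of_real x)) * exp (- (\<i> * of_real (pi / 2 * real n)))"
    unfolding exp_add[symmetric] by (simp add: algebra_simps)
  have E2: "exp (- (\<i> * (y - of_real (\<nu> * x) - of_real (pi / 2 * real n))))
      = exp (- \<i> * y) * exp (of_real \<nu> * (\<i> * of_real x)) * exp (\<i> * of_real (pi / 2 * real n))"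
    unfolding exp_add[symmetric] by (simp add: algebra_simps)
  show ?thesis
    unfolding sin_exp_eq E1 E2 e e' power_mult_distrib by (simp add: algebra_simps)
qed

text \<open>For real \<open>x\<close> and \<nu> the real part is the mean of a number and its
  conjugate. Conjugation changes the exponent i pi - x into -i pi - x, which yields two exponential
  moments even when the weight is complex.\<close>

lemma Re_power_exp_eq:
  "of_real (x ^ n * exp (\<nu> * x) + exp (- \<nu> * x) *
      Re ((\<i> * of_real pi - of_real x) ^ n * exp (\<i> * of_real (pi * \<nu>)))) =
    of_real x ^ n * exp (of_real \<nu> * of_real x)
    + ((\<i> * of_real pi - of_real x) ^ n * exp (of_real \<nu> * (\<i> * of_real pi - of_real x))
      + (- \<i> * of_real pi - of_real x) ^ n * exp (of_real \<nu> * (- \<i> * of_real pi - of_real x))) / 2"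
proof -
  let ?z = "(\<i> * of_real pi - of_real x) ^ n * exp (of_real \<nu> * (\<i> * of_real pi - of_real x))"
  have "?z = of_real (exp (- \<nu> * x)) * ((\<i> * of_real pi - of_real x) ^ n * exp (\<i> * of_real (pi * \<nu>)))"
    by (simp add: algebra_simps exp_add[symmetric] exp_of_real[symmetric])
  then have "Re ?z = exp (- \<nu> * x) * Re ((\<i> * of_real pi - of_real x) ^ n * exp (\<i> * of_real (pi * \<nu>)))"
    by (simp only: Re_complex_of_real Im_complex_of_real times_complex.sel mult_zero_left diff_zero)
  then have "of_real (x ^ n * exp (\<nu> * x) + exp (- \<nu> * x) *
      Re ((\<i> * of_real pi - of_real x) ^ n * exp (\<i> * of_real (pi * \<nu>))))
    = of_real x ^ n * exp (of_real \<nu> * of_real x) + of_real (Re ?z)"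
    by (simp only: of_real_add of_real_mult of_real_power flip: exp_of_real)
  also have "of_real (Re ?z) = (?z + cnj ?z) / 2"
    by (simp only: complex_add_cnj of_real_mult of_real_numeral nonzero_mult_div_cancel_left
        zero_neq_numeral[symmetric] simp_thms)
  also have "cnj ?z = (- \<i> * of_real pi - of_real x) ^ n * exp (of_real \<nu> * (- \<i> * of_real pi - of_real x))"
    by (simp add: exp_cnj)
  finally show ?thesis .
qed

text \<open>Differentiability at lower orders and integrability on the half-line are asserted as
  well, so that no default value of \<open>vector_derivative\<close> or \<open>integral\<close> can
  enter the formulas.\<close>

theorem mainTheorem2:
  fixes n :: nat and \<nu> :: real and t :: complex
  assumes "Re t > 0"
  shows
    "(\<forall>m<n. \<forall>\<mu>. nth_derivative m (\<lambda>\<mu>. bessel_Y (of_real \<mu>) t) differentiable (at \<mu>)) \<and>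
     (\<lambda>x::real. exp (- t * of_real (sinh x)) *
        of_real (x ^ n * exp (\<nu> * x) +
          exp (- \<nu> * x) * Re ((\<i> * of_real pi - of_real x) ^ n * exp (\<i> * of_real (pi * \<nu>)))))
       integrable_on {0..} \<and>
     (\<lambda>x::real. exp (- t * of_real (sinh x)) *
        of_real (x ^ n * exp (\<nu> * x) +
          exp (- \<nu> * x) * (p_poly n x * cos (pi * \<nu>) - q_poly n x * sin (pi * \<nu>))))
       integrable_on {0..} \<and>
     nth_derivative n (\<lambda>\<mu>. bessel_Y (of_real \<mu>) t) \<nu> =
       1 / of_real pi * integral {0..pi} (\<lambda>x::real.
         of_real (x ^ n) * sin (t * of_real (sin x) - of_real (\<nu> * x) - of_real (pi / 2 * real n)))
       - 1 / of_real pi * integral {0..} (\<lambda>x::real. exp (- t * of_real (sinh x)) *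
           of_real (x ^ n * exp (\<nu> * x) +
             exp (- \<nu> * x) * Re ((\<i> * of_real pi - of_real x) ^ n * exp (\<i> * of_real (pi * \<nu>))))) \<and>
     nth_derivative n (\<lambda>\<mu>. bessel_Y (of_real \<mu>) t) \<nu> =
       1 / of_real pi * integral {0..pi} (\<lambda>x::real.
         of_real (x ^ n) * sin (t * of_real (sin x) - of_real (\<nu> * x) - of_real (pi / 2 * real n)))
       - 1 / of_real pi * integral {0..} (\<lambda>x::real. exp (- t * of_real (sinh x)) *
           of_real (x ^ n * exp (\<nu> * x) +
             exp (- \<nu> * x) * (p_poly n x * cos (pi * \<nu>) - q_poly n x * sin (pi * \<nu>))))"
proof -
  note t = assms
  let ?R = "\<lambda>x::real. exp (- t * of_real (sinh x)) *
        of_real (x ^ n * exp (\<nu> * x) +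
          exp (- \<nu> * x) * Re ((\<i> * of_real pi - of_real x) ^ n * exp (\<i> * of_real (pi * \<nu>))))"
  let ?Q = "\<lambda>x::real. exp (- t * of_real (sinh x)) *
        of_real (x ^ n * exp (\<nu> * x) +
          exp (- \<nu> * x) * (p_poly n x * cos (pi * \<nu>) - q_poly n x * sin (pi * \<nu>)))"
  let ?S = "\<lambda>x::real. of_real (x ^ n) *
      sin (t * of_real (sin x) - of_real (\<nu> * x) - of_real (pi / 2 * real n))"
  let ?w = "\<lambda>x. exp (- t * of_real (sinh x))"
  let ?M = "\<lambda>c x. ?w x * c x ^ n * exp (of_real \<nu> * c x)"
  \<comment> \<open>Euler's formula for exp(i pi nu), followed by taking the real part of the
    product.\<close>
  have RQ: "?R = ?Q"
    unfolding p_poly_def q_poly_def cis_conv_exp[symmetric] by simp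
  have R: "?R = (\<lambda>x. ?M of_real x + (?M (\<lambda>x. \<i> * of_real pi - of_real x) x
      + ?M (\<lambda>x. - \<i> * of_real pi - of_real x) x) / 2)"
    unfolding Re_power_exp_eq by (simp add: fun_eq_iff algebra_simps)
  have Rint: "(?R has_integral exp_moment {0..} ?w of_real n (of_real \<nu>)
      + (exp_moment {0..} ?w (\<lambda>x. \<i> * of_real pi - of_real x) n (of_real \<nu>)
        + exp_moment {0..} ?w (\<lambda>x. - \<i> * of_real pi - of_real x) n (of_real \<nu>)) / 2) {0..}"
    unfolding R
    by (intro has_integral_add has_integral_divide has_integral_exp_moment exp_integrable_sinh_exponents t)
  have S: "?S = (\<lambda>x. (exp (\<i> * t * of_real (sin x)) * (- \<i> * of_real x) ^ n * exp (of_real \<nu> * (- \<i> * of_real x))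
      - exp (- \<i> * t * of_real (sin x)) * (\<i> * of_real x) ^ n * exp (of_real \<nu> * (\<i> * of_real x))) / (2 * \<i>))"
    unfolding of_real_power sin_minus_half_pi_multiple by (simp only: mult.assoc)
  have Sint: "(?S has_integral
      (exp_moment {0..pi} (\<lambda>x. exp (\<i> * t * of_real (sin x))) (\<lambda>x. - \<i> * of_real x) n (of_real \<nu>)
      - exp_moment {0..pi} (\<lambda>x. exp (- \<i> * t * of_real (sin x))) (\<lambda>x. \<i> * of_real x) n (of_real \<nu>)) / (2 * \<i>)) {0..pi}"
    unfolding S
    by (intro has_integral_divide has_integral_diff has_integral_exp_moment exp_integrable_compact
        continuous_intros)
  have diff: "nth_derivative m (\<lambda>\<mu>. bessel_Y (of_real \<mu>) t) differentiable (at \<mu>)" for m \<mu>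
    unfolding nth_derivative_bessel_Y[OF t]
    by (rule differentiableI_vector, rule has_vector_derivative_real_field,
        rule bessel_Y_integral_has_field_derivative[OF t])
  have val: "nth_derivative n (\<lambda>\<mu>. bessel_Y (of_real \<mu>) t) \<nu> =
       1 / of_real pi * integral {0..pi} ?S - 1 / of_real pi * integral {0..} ?R"
    unfolding nth_derivative_bessel_Y[OF t] bessel_Y_integral_def
      integral_unique[OF Rint] integral_unique[OF Sint]
    by (simp only: right_diff_distrib)
  show ?thesis
    using diff val has_integral_integrable[OF Rint] unfolding RQ by blast
qed

end
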